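(* Let $x,y$ be real numbers with $y\neq 0$, $x+y\neq 0$ and $x/(x+y)\geq 0$, let $z\in(-\infty,1]$, and let $n,p,m$ be positive integers. Then \[ \sum_{k=0}^n x^ky^{n-k}\binom{n}{k}\, \zeta_k^\star(\{1\}_{p-1},m+1;z) =(-1)^{m+p}(x+y)^n \sum_{n\geq j\geq l\geq 1} \left(\frac{y}{x+y}\right)^j \left( \left(1+\frac{xz}{y}\right)^l-1\right)\left\{\sum_{i=0}^{p-1} (-1)^i \frac{Y_i(n)}{i!}\, \frac{s(j,p-i)}{j!}\right\}\left\{\sum_{h=0}^{m-1} (-1)^h \frac{Y_h(j)}{h!}\, \frac{s(l,m-h)}{l!}\right\}. \]
   Context: For a composition $\mathbf{k}=(k_1,\ldots,k_r)$ of positive integers, an integer $n\geq 0$ and a real $z$, define $\zeta^\star_n(\mathbf{k};z):=\sum_{n\geq n_1\geq\cdots\geq n_r\geq 1} \frac{z^{n_r}}{n_1^{k_1}\cdots n_r^{k_r}}$ (an empty sum, equal to $0$, when $n=0$). Here $(\{1\}_{p-1},m+1)$ is the composition $(1,\ldots,1,m+1)$ with $p-1$ ones followed by $m+1$. The convention $0^0=1$ is used. $s(n,k)$ denotes the unsigned Stirling numbers of the first kind: $s(0,0)=1$, $s(n,0)=s(0,k)=0$ for $n,k\geq1$, and $s(n,k)=s(n-1,k-1)+(n-1)s(n-1,k)$ for $n,k\geq1$. For $n\geq0,k\geq1$ let $H_n^{(k)}=\sum_{j=1}^n j^{-k}$, $H_n=H_n^{(1)}$. The complete exponential Bell polynomials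 are defined by $\exp\big(\sum_{i\geq1} x_i t^i/i!\big)=\sum_{k\geq0} Y_k(x_1,\ldots,x_k)\,t^k/k!$, and $Y_k(n):=Y_k\big(H_n,1!H_n^{(2)},\ldots,(k-1)!H_n^{(k)}\big)$, with $Y_0(n)=1$. *)

theory Defs
  imports
    Complex_Main
    "HOL-Computational_Algebra.Formal_Power_Series"
    "HOL-Combinatorics.Stirling"
begin

(* A composition k = (k_1,...,k_r) is a non-empty list of positive integers; the summation
   indices n >= n_1 >= ... >= n_r >= 1 form a weakly decreasing list of the same length.
   Only used with ks \<noteq> [], so that last ns = n_r is meaningful. *)
definition zeta_star_indices :: "nat \<Rightarrow> nat \<Rightarrow> nat list set" where
  "zeta_star_indices n r = {ns. length ns = r \<and> set ns \<subseteq> {1..n} \<and> sorted_wrt (\<ge>) ns}"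

definition zeta_star :: "nat \<Rightarrow> nat list \<Rightarrow> real \<Rightarrow> real" where
  "zeta_star n ks z =
     (\<Sum>ns\<in>zeta_star_indices n (length ks).
        z ^ last ns / (\<Prod>i<length ks. real (ns ! i) ^ (ks ! i)))"

definition gen_harmonic :: "nat \<Rightarrow> nat \<Rightarrow> real" where
  "gen_harmonic k n = (\<Sum>j=1..n. 1 / real j ^ k)"

(* Complete exponential Bell polynomial Y_k(x_1,...,x_k), read off as k! times the coefficient
   of t^k in exp(\<Sum>i\<ge>1. x_i t^i / i!); oo is composition of formal power series.
   The arguments are passed as a sequence x, whose entry x 0 is ignored. *)
definition bell_Y :: "nat \<Rightarrow> (nat \<Rightarrow> real) \<Rightarrow> real" where
  "bell_Y k x =
     fact k * fps_nth (fps_exp 1 oo Abs_fps (\<lambda>i. if i = 0 then 0 else x i / fact i)) k"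

definition harmonic_Y :: "nat \<Rightarrow> nat \<Rightarrow> real" where
  "harmonic_Y k n = bell_Y k (\<lambda>i. fact (i - 1) * gen_harmonic i n)"

end

theory Submission
  imports Defs
begin

text \<open>
  Up to the sign $(-1)^p$, the inner sums are the coefficients $w(n,j,p)$ of $t^p$ in
  $\prod_{i\le n}(1-t/i)^{-1}\cdot(-t)(1-t)\cdots(j-1-t)/j!$. Hence, for $p\ge 1$, the sum
  $\sum_{j=1}^n f(j)\,w(n,j,p)$ is $g(n,p)$ for the only solution $g$ of
  $g(n,p)=g(n-1,p)+g(n,p-1)/n$ with $g(0,p)=0$ and $g(n,0)=-f(n)$.
  Binomial transforms turn the defining recurrence of the star sums into the same recurrence,
  and so does $\sum_k\binom nk v^k/k^m$ in $(n,m)$; thus the uniqueness is applied once for the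
  sum over $l$ and once for the sum over $j$.
\<close>

section \<open>Generating functions of the inner sums\<close>

text \<open>With t the series variable, this is -log of the product of (1 - t/j) over j =
  1..n.\<close>

definition harmonic_fps :: "nat \<Rightarrow> real fps" where
  "harmonic_fps n = Abs_fps (\<lambda>i. if i = 0 then 0 else gen_harmonic i n / real i)"

definition harmonic_Y_fps :: "nat \<Rightarrow> real fps" where
  "harmonic_Y_fps n = fps_exp 1 oo harmonic_fps n"

text \<open>The polynomial (-t)(1-t)...(j-1-t): the unsigned Stirling numbers are the coefficients
  of the rising factorial.\<close>

definition signed_stirling_fps :: "nat \<Rightarrow> real fps" where
  "signed_stirling_fps j = Abs_fps (\<lambda>k. (-1) ^ k * real (stirling j k))"

text \<open>The w(n,j,p) of the overview. Keeping the sign (-1)^p inside makes its recurrence free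
  of signs.\<close>

definition stirling_weight :: "nat \<Rightarrow> nat \<Rightarrow> nat \<Rightarrow> real" where
  "stirling_weight n j p = fps_nth (harmonic_Y_fps n * signed_stirling_fps j) p / fact j"

lemma harmonic_Y_fps_nth: "fps_nth (harmonic_Y_fps n) i = harmonic_Y i n / fact i"
proof -
  have "Abs_fps (\<lambda>i. if i = 0 then 0 else fact (i - 1) * gen_harmonic i n / fact i)
      = harmonic_fps n"
    by (auto simp: fps_eq_iff harmonic_fps_def fact_reduce)
  then show ?thesis
    by (simp only: harmonic_Y_fps_def harmonic_Y_def bell_Y_def) simp
qed

lemma stirling_weight_eq:
  assumes "j \<ge> 1"
  shows "stirling_weight n j p = (-1) ^ p * (\<Sum>i=0..p - 1. (-1) ^ i * (harmonic_Y i n / fact i)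
                    * (real (stirling j (p - i)) / fact j))"
proof -
  have s0: "stirling j 0 = 0" using assms by (cases j) auto
  have "fps_nth (harmonic_Y_fps n * signed_stirling_fps j) p
      = (\<Sum>i=0..p. (harmonic_Y i n / fact i) * ((-1) ^ (p - i) * real (stirling j (p - i))))"
    by (simp add: fps_mult_nth harmonic_Y_fps_nth signed_stirling_fps_def)
  also have "\<dots> = (\<Sum>i=0..p - 1. (harmonic_Y i n / fact i)
      * ((-1) ^ (p - i) * real (stirling j (p - i))))"
    \<comment> \<open>Only i = p can drop out, and there s(j,0) = 0; for p = 0 truncated subtraction
      makes the two ranges equal.\<close>
    by (rule sum.mono_neutral_right) (auto simp: s0 not_le)
  also have "\<dots> = (\<Sum>i=0..p - 1. (-1) ^ p * ((-1) ^ i * (harmonic_Y i n / fact i)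
                    * real (stirling j (p - i))))"
  proof (rule sum.cong[OF refl])
    fix i assume "i \<in> {0..p - 1}"
    then have "(-1 :: real) ^ (p - i) = (-1) ^ p * (-1) ^ i"
      by (simp add: power_diff_conv_inverse)
    then show "(harmonic_Y i n / fact i) * ((-1) ^ (p - i) * real (stirling j (p - i)))
      = (-1) ^ p * ((-1) ^ i * (harmonic_Y i n / fact i) * real (stirling j (p - i)))"
      by simp
  qed
  finally show ?thesis
    by (simp add: stirling_weight_def sum_distrib_left sum_divide_distrib)
qed

lemma signed_stirling_fps_Suc:
  "signed_stirling_fps (Suc j) = (of_nat j - fps_X) * signed_stirling_fps j"
proof (rule fps_ext)
  fix k
  show "fps_nth (signed_stirling_fps (Suc j)) k
      = fps_nth ((of_nat j - fps_X) * signed_stirling_fps j) k"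
    by (cases k) (cases j; simp add: signed_stirling_fps_def algebra_simps)+
qed

lemma harmonic_fps_deriv_nth: "fps_nth (fps_deriv (harmonic_fps n)) k = gen_harmonic (Suc k) n"
  by (simp add: harmonic_fps_def del: of_nat_Suc)

lemma gen_harmonic_Suc: "gen_harmonic k (Suc n) = gen_harmonic k n + (1 / real (Suc n)) ^ k"
  by (simp add: gen_harmonic_def power_divide)

text \<open>The series gains the summand -log(1 - t/(n+1)), whose derivative is (1/(n+1)) / (1 -
  t/(n+1)); clearing the denominator avoids inverses.\<close>

lemma harmonic_fps_Suc_deriv:
  "(1 - fps_const (1 / real (Suc n)) * fps_X) * fps_deriv (harmonic_fps (Suc n))
    = (1 - fps_const (1 / real (Suc n)) * fps_X) * fps_deriv (harmonic_fps n)
      + fps_const (1 / real (Suc n))"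
proof (rule fps_ext)
  fix k
  show "fps_nth ((1 - fps_const (1 / real (Suc n)) * fps_X) * fps_deriv (harmonic_fps (Suc n))) k
    = fps_nth ((1 - fps_const (1 / real (Suc n)) * fps_X) * fps_deriv (harmonic_fps n)
      + fps_const (1 / real (Suc n))) k"
    by (cases k) (simp_all add: left_diff_distrib mult.assoc harmonic_fps_deriv_nth
        gen_harmonic_Suc distrib_left del: of_nat_Suc fps_deriv_nth)
qed

lemma harmonic_Y_fps_deriv:
  "fps_deriv (harmonic_Y_fps n) = harmonic_Y_fps n * fps_deriv (harmonic_fps n)"
  unfolding harmonic_Y_fps_def
  by (subst fps_compose_deriv) (simp_all add: harmonic_fps_def)

lemma harmonic_Y_fps_nth_0: "fps_nth (harmonic_Y_fps n) 0 = 1"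
  by (simp add: harmonic_Y_fps_def)

text \<open>Both sides solve F' = F h with constant term 1, so their quotient is the constant
  1.\<close>

lemma harmonic_Y_fps_Suc:
  "(1 - fps_const (1 / real (Suc n)) * fps_X) * harmonic_Y_fps (Suc n) = harmonic_Y_fps n"
proof -
  define q where "q = 1 - fps_const (1 / real (Suc n)) * fps_X"
  define F where "F = q * harmonic_Y_fps (Suc n)"
  define E where "E = harmonic_Y_fps n"
  define h where "h = fps_deriv (harmonic_fps n)"
  have dq: "fps_deriv q = - fps_const (1 / real (Suc n))"
    by (simp add: q_def)
  have "fps_deriv F = harmonic_Y_fps (Suc n) * (q * fps_deriv (harmonic_fps (Suc n)) + fps_deriv q)"
    by (simp add: F_def harmonic_Y_fps_deriv algebra_simps)
  also have "q * fps_deriv (harmonic_fps (Suc n)) + fps_deriv q = q * h"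
    using harmonic_fps_Suc_deriv[of n] by (simp add: dq q_def h_def)
  finally have dF: "fps_deriv F = F * h"
    by (simp add: F_def algebra_simps)
  have dE: "fps_deriv E = E * h"
    by (simp add: E_def h_def harmonic_Y_fps_deriv)
  have E0: "fps_nth E 0 = 1" "fps_nth F 0 = 1"
    by (simp_all add: E_def F_def q_def harmonic_Y_fps_nth_0)
  have inv: "inverse E * E = 1"
    using E0 by (intro inverse_mult_eq_1) simp
  \<comment> \<open>The quotient rule with E' = E h; the factor \<open>inverse E * E\<close> is left
    standing and becomes 1 by \<open>inv\<close>.\<close>
  have "fps_deriv (F * inverse E) = F * h * inverse E - F * h * inverse E * (inverse E * E)"
    using E0 by (simp add: fps_inverse_deriv dE dF power2_eq_square algebra_simps)
  then have "fps_deriv (F * inverse E) = 0"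
    by (simp add: inv)
  then have "F * inverse E = fps_const (fps_nth (F * inverse E) 0)"
    by (simp only: fps_deriv_eq_0_iff)
  also have "fps_nth (F * inverse E) 0 = 1"
    using E0 by simp
  finally have "F * inverse E * E = E"
    by simp
  then have "F = E"
    by (simp add: inv mult.assoc)
  then show ?thesis by (simp add: F_def E_def q_def)
qed

text \<open>The factors i - t = i (1 - t/i) for i = 1..n cancel against the product of inverses,
  which leaves -n! t.\<close>

lemma harmonic_Y_fps_times_signed_stirling_fps:
  "harmonic_Y_fps n * signed_stirling_fps (Suc n) = - fps_const (fact n) * fps_X"
proof (induction n)
  case 0
  have "harmonic_Y_fps 0 = 1"
  proof -
    have "harmonic_fps 0 = 0"
      by (auto simp: fps_eq_iff harmonic_fps_def gen_harmonic_def)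
    then show ?thesis by (simp add: harmonic_Y_fps_def)
  qed
  moreover have "signed_stirling_fps 0 = 1"
    by (auto simp: fps_eq_iff signed_stirling_fps_def gr0_conv_Suc)
  ultimately show ?case by (simp add: signed_stirling_fps_Suc)
next
  case (Suc n)
  have "of_nat (Suc n) - fps_X
      = of_nat (Suc n) * (1 - fps_const (1 / real (Suc n)) * fps_X)"
    by (rule fps_ext) (simp add: fps_of_nat[symmetric] algebra_simps del: of_nat_Suc)
  then have "harmonic_Y_fps (Suc n) * signed_stirling_fps (Suc (Suc n))
     = of_nat (Suc n) * (((1 - fps_const (1 / real (Suc n)) * fps_X) * harmonic_Y_fps (Suc n))
        * signed_stirling_fps (Suc n))"
    by (simp only: signed_stirling_fps_Suc[of "Suc n"] mult_ac)
  also have "\<dots> = of_nat (Suc n) * (- fps_const (fact n) * fps_X)"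
    by (simp only: harmonic_Y_fps_Suc Suc.IH)
  also have "\<dots> = - fps_const (fact (Suc n)) * fps_X"
    by (rule fps_ext) (simp add: fps_of_nat[symmetric] algebra_simps)
  finally show ?case .
qed

section \<open>Recurrence and uniqueness for the weights\<close>

lemma stirling_weight_0: "j \<ge> 1 \<Longrightarrow> stirling_weight n j 0 = 0"
  by (cases j) (simp_all add: stirling_weight_def signed_stirling_fps_def)

text \<open>At j = n+1 only the first power of t survives, so a new top index is felt only for p =
  1.\<close>

lemma stirling_weight_Suc_diag:
  "stirling_weight n (Suc n) p = (if p = 1 then - 1 / real (Suc n) else 0)"
  by (simp add: stirling_weight_def harmonic_Y_fps_times_signed_stirling_fps)

lemma stirling_weight_Suc:
  "stirling_weight (Suc n) j (Suc p)
    = stirling_weight n j (Suc p) + stirling_weight (Suc n) j p / real (Suc n)"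
proof -
  define A where "A = harmonic_Y_fps (Suc n) * signed_stirling_fps j"
  have "harmonic_Y_fps n * signed_stirling_fps j = A - fps_const (1 / real (Suc n)) * (fps_X * A)"
    by (simp add: A_def harmonic_Y_fps_Suc[of n, symmetric] algebra_simps)
  then have "fps_nth (harmonic_Y_fps n * signed_stirling_fps j) (Suc p)
      = fps_nth A (Suc p) - fps_nth A p / real (Suc n)"
    by simp
  then show ?thesis
    unfolding stirling_weight_def A_def[symmetric]
    by (simp add: diff_divide_distrib mult.commute del: of_nat_Suc)
qed

text \<open>The weighted sum obeys \<open>rec\<close> too: passing from n to n+1, the new term j =
  n+1 vanishes for exponents above 1 and is -f(n+1)/(n+1) = g(n+1,0)/(n+1) for exponent 1. Hence an
  outer induction on p and an inner one on n.\<close>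

lemma stirling_transform_unique:
  fixes f :: "nat \<Rightarrow> real" and g :: "nat \<Rightarrow> nat \<Rightarrow> real"
  assumes rec: "\<And>n p. g (Suc n) (Suc p) = g n (Suc p) + g (Suc n) p / real (Suc n)"
    and g0: "\<And>p. g 0 (Suc p) = 0"
    and init: "\<And>n. g (Suc n) 0 = - f (Suc n)"
  shows "(\<Sum>j=1..n. f j * stirling_weight n j (Suc p)) = g n (Suc p)"
proof (induction p arbitrary: n)
  case 0
  show ?case
  proof (induction n)
    case 0
    then show ?case by (simp add: g0)
  next
    case (Suc n)
    have "(\<Sum>j=1..Suc n. f j * stirling_weight (Suc n) j (Suc 0))
        = (\<Sum>j=1..Suc n. f j * stirling_weight n j (Suc 0))"
      by (rule sum.cong) (simp_all add: stirling_weight_Suc stirling_weight_0)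
    also have "\<dots> = g n (Suc 0) - f (Suc n) / real (Suc n)"
      using Suc by (simp add: stirling_weight_Suc_diag)
    finally show ?case by (simp add: rec init)
  qed
next
  case (Suc p)
  show ?case
  proof (induction n)
    case 0
    then show ?case by (simp add: g0)
  next
    case (Suc n)
    have "(\<Sum>j=1..Suc n. f j * stirling_weight (Suc n) j (Suc (Suc p)))
        = (\<Sum>j=1..Suc n. f j * stirling_weight n j (Suc (Suc p)))
          + (\<Sum>j=1..Suc n. f j * stirling_weight (Suc n) j (Suc p)) / real (Suc n)"
      by (simp only: stirling_weight_Suc[of n _ "Suc p"] distrib_left sum.distrib
          times_divide_eq_right sum_divide_distrib)
    also have "(\<Sum>j=1..Suc n. f j * stirling_weight n j (Suc (Suc p))) = g n (Suc (Suc p))"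
      using Suc.IH by (simp add: stirling_weight_Suc_diag)
    \<comment> \<open>The fact quoted by its pattern is the outer induction hypothesis; the inner
      case has rebound the name \<open>Suc\<close>.\<close>
    finally show ?case by (simp only: rec \<open>\<And>n. _ n = g n (Suc p)\<close>)
  qed
qed

section \<open>Binomial transforms\<close>

definition binomial_transform :: "real \<Rightarrow> real \<Rightarrow> (nat \<Rightarrow> real) \<Rightarrow> nat \<Rightarrow> real" where
  "binomial_transform a b f n = (\<Sum>k=0..n. a ^ k * b ^ (n - k) * real (n choose k) * f k)"

text \<open>Absorption (k+1) C(n+1,k+1) = (n+1) C(n,k); the term k = 0 vanishes.\<close>

lemma binomial_transform_absorb:
  "binomial_transform a b (\<lambda>k. real k * f k) (Suc n)
    = real (Suc n) * (a * binomial_transform a b (\<lambda>k. f (Suc k)) n)"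
proof -
  have "binomial_transform a b (\<lambda>k. real k * f k) (Suc n)
      = (\<Sum>k=0..n. a ^ Suc k * b ^ (n - k) * (real (Suc n choose Suc k) * real (Suc k)) * f (Suc k))"
    unfolding binomial_transform_def
    by (subst sum.atLeast0_atMost_Suc_shift)
       (simp add: mult_ac del: binomial_Suc_Suc of_nat_Suc)
  also have "\<dots> = (\<Sum>k=0..n. a ^ Suc k * b ^ (n - k) * (real (Suc n) * real (n choose k)) * f (Suc k))"
    by (simp only: of_nat_mult[symmetric] Suc_times_binomial_eq)
  finally show ?thesis
    by (simp add: binomial_transform_def sum_distrib_left mult_ac del: of_nat_Suc)
qed

text \<open>Pascal's rule, applied to every term with k >= 1.\<close>

lemma binomial_transform_Suc:
  "binomial_transform a b f (Suc n)
    = b * binomial_transform a b f n + a * binomial_transform a b (\<lambda>k. f (Suc k)) n"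
proof -
  have "binomial_transform a b f (Suc n) = b ^ Suc n * f 0
      + (\<Sum>k=0..n. a ^ Suc k * b ^ (n - k) * real (Suc n choose Suc k) * f (Suc k))"
    unfolding binomial_transform_def
    by (subst sum.atLeast0_atMost_Suc_shift) (simp del: binomial_Suc_Suc)
  also have "\<dots> = b ^ Suc n * f 0
      + (\<Sum>k=0..n. a ^ Suc k * b ^ (n - k) * real (n choose Suc k) * f (Suc k))
      + (\<Sum>k=0..n. a ^ Suc k * b ^ (n - k) * real (n choose k) * f (Suc k))"
    by (simp add: algebra_simps sum.distrib)
  also have "b ^ Suc n * f 0
      + (\<Sum>k=0..n. a ^ Suc k * b ^ (n - k) * real (n choose Suc k) * f (Suc k))
      = (\<Sum>k=0..Suc n. a ^ k * b ^ (Suc n - k) * real (n choose k) * f k)"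
    by (subst sum.atLeast0_atMost_Suc_shift) simp
  \<comment> \<open>The top index drops out because C(n,n+1) = 0.\<close>
  also have "\<dots> = b * binomial_transform a b f n"
    by (simp add: binomial_transform_def sum_distrib_left Suc_diff_le mult_ac)
  finally show ?thesis
    by (simp add: binomial_transform_def sum_distrib_left mult_ac)
qed

lemma binomial_transform_diff:
  "binomial_transform a b (\<lambda>k. f k - g k) n = binomial_transform a b f n - binomial_transform a b g n"
  by (simp add: binomial_transform_def algebra_simps sum_subtractf)

text \<open>Homogeneity of degree n in (a,b); taking c = x + y gives parameters of sum 1.\<close>

lemma binomial_transform_scale:
  assumes "c \<noteq> 0"
  shows "binomial_transform a b f n = c ^ n * binomial_transform (a / c) (b / c) f n"
proof -
  have "a ^ k * b ^ (n - k) = c ^ n * ((a / c) ^ k * (b / c) ^ (n - k))" if "k \<le> n" for k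
    using that assms by (simp add: power_divide power_add[symmetric] field_simps)
  then show ?thesis
    unfolding binomial_transform_def sum_distrib_left
    by (intro sum.cong) (simp_all add: mult_ac)
qed

text \<open>As b = 1 - a, Pascal's rule makes the increment in n equal to a times the transform of
  f(k+1) - f(k) = g(k+1)/(k+1), which absorption expresses through g.\<close>

lemma binomial_transform_recurrence:
  assumes "a + b = 1" and "\<And>k. f (Suc k) = f k + g (Suc k) / real (Suc k)" and "g 0 = 0"
  shows "binomial_transform a b f (Suc n)
    = binomial_transform a b f n + binomial_transform a b g (Suc n) / real (Suc n)"
proof -
  \<comment> \<open>At k = 0 the left side is 0, which is where \<open>g 0 = 0\<close>
    enters.\<close>
  have "(\<lambda>k. real k * (g k / real k)) = g"
    using assms(3) by (auto simp: fun_eq_iff)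
  then have "binomial_transform a b g (Suc n) / real (Suc n)
      = a * binomial_transform a b (\<lambda>k. g (Suc k) / real (Suc k)) n"
    using binomial_transform_absorb[of a b "\<lambda>k. g k / real k" n]
    by (simp add: field_simps)
  also have "(\<lambda>k. g (Suc k) / real (Suc k)) = (\<lambda>k. f (Suc k) - f k)"
    using assms(2) by auto
  finally have g: "binomial_transform a b g (Suc n) / real (Suc n)
      = a * binomial_transform a b (\<lambda>k. f (Suc k)) n - a * binomial_transform a b f n"
    by (simp only: binomial_transform_diff right_diff_distrib)
  have b: "b * t = t - a * t" for t
    using assms(1) by (simp add: eq_diff_eq flip: distrib_right)
  show ?thesis
    unfolding g by (simp add: binomial_transform_Suc[of a b f] b)
qed

text \<open>Uniqueness with f(l) = (1+v)^l - 1: the right side is a binomial transform whose row of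
  exponent 0 is -f by the binomial theorem. This evaluates the sum over l.\<close>

lemma sum_stirling_weight_power:
  assumes "m \<ge> 1"
  shows "(\<Sum>l=1..j. ((1 + v) ^ l - 1) * stirling_weight j l m)
    = - (\<Sum>b=1..j. real (j choose b) * v ^ b / real b ^ m)"
proof -
  \<comment> \<open>The term at index 0 has to vanish also for exponent 0, where $0^0=1$ would spoil it.\<close>
  define u where "u = (\<lambda>m k. if k = 0 then 0 else 1 / real k ^ m)"
  define g where "g = (\<lambda>n m. - binomial_transform v 1 (u m) n)"
  have g: "g n m = - (\<Sum>b=1..n. real (n choose b) * v ^ b / real b ^ m)" for n m
    by (simp add: g_def binomial_transform_def u_def sum.atLeast_Suc_atMost[of 0] mult_ac)
  have u: "(\<lambda>k. real k * u (Suc m) k) = u m" for m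
    by (auto simp: u_def)
  obtain m' where m': "m = Suc m'" using assms by (cases m) auto
  have "(\<Sum>l=1..j. ((1 + v) ^ l - 1) * stirling_weight j l (Suc m')) = g j (Suc m')"
  proof (rule stirling_transform_unique)
    \<comment> \<open>The parameters v and 1 need not sum to 1, but with b = 1 Pascal's rule and
      absorption combine directly.\<close>
    show "g (Suc n) (Suc p) = g n (Suc p) + g (Suc n) p / real (Suc n)" for n p
      using binomial_transform_absorb[of v 1 "u (Suc p)" n]
      by (simp add: g_def u binomial_transform_Suc[of v 1 "u (Suc p)"])
    show "g 0 (Suc p) = 0" for p by (simp add: g)
    show "g (Suc n) 0 = - ((1 + v) ^ Suc n - 1)" for n
    proof -
      have "(1 + v) ^ Suc n = (\<Sum>b=0..Suc n. real (Suc n choose b) * v ^ b)"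
        by (subst add.commute, subst binomial_ring) (simp add: atLeast0AtMost)
      also have "\<dots> = 1 + (\<Sum>b=1..Suc n. real (Suc n choose b) * v ^ b)"
        by (subst sum.atLeast_Suc_atMost) (simp_all del: binomial_Suc_Suc)
      finally show ?thesis by (simp add: g del: binomial_Suc_Suc)
    qed
  qed
  then show ?thesis by (simp add: g m')
qed

section \<open>Recursion for the star sums in their first index\<close>

lemma finite_zeta_star_indices: "finite (zeta_star_indices n r)"
  by (rule finite_subset[OF _ finite_lists_length_eq[of "{1..n}" r]])
     (auto simp: zeta_star_indices_def)

lemma zeta_star_indices_Suc:
  "zeta_star_indices n (Suc r) = (\<Union>a\<in>{1..n}. (#) a ` zeta_star_indices a r)"
  by (auto simp: zeta_star_indices_def length_Suc_conv image_iff) force+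

lemma zeta_star_indices_0: "zeta_star_indices n 0 = {[]}"
  by (auto simp: zeta_star_indices_def)

text \<open>Splits off n_1 = a, which bounds the remaining indices. Keeping
  \<open>last (a # ns)\<close> covers empty \<open>ks\<close> as well.\<close>

lemma zeta_star_Cons_sum:
  "zeta_star n (k # ks) z = (\<Sum>a=1..n. \<Sum>ns\<in>zeta_star_indices a (length ks).
      z ^ last (a # ns) / (real a ^ k * (\<Prod>i<length ks. real (ns ! i) ^ (ks ! i))))"
proof -
  have "zeta_star n (k # ks) z = (\<Sum>a=1..n. \<Sum>ns\<in>(#) a ` zeta_star_indices a (length ks).
      z ^ last ns / (\<Prod>i<Suc (length ks). real (ns ! i) ^ ((k # ks) ! i)))"
    unfolding zeta_star_def list.size add_0_right add_Suc_right zeta_star_indices_Suc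
    by (rule sum.UNION_disjoint) (auto intro: finite_zeta_star_indices)
  then show ?thesis
    by (simp add: sum.reindex prod.lessThan_Suc_shift del: prod.lessThan_Suc)
qed

lemma zeta_star_singleton: "zeta_star n [k] z = (\<Sum>a=1..n. z ^ a / real a ^ k)"
  by (simp add: zeta_star_Cons_sum zeta_star_indices_0)

lemma zeta_star_Cons:
  assumes "ks \<noteq> []"
  shows "zeta_star n (k # ks) z = (\<Sum>a=1..n. zeta_star a ks z / real a ^ k)"
proof -
  have "last (a # ns) = last ns" if "ns \<in> zeta_star_indices c (length ks)" for a c ns
    using that assms by (auto simp: zeta_star_indices_def)
  then show ?thesis
    unfolding zeta_star_Cons_sum unfolding zeta_star_def sum_divide_distrib
    by (intro sum.cong refl) (simp add: mult_ac)
qed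

section \<open>Uniqueness applied to the transformed star sums\<close>

theorem theorem1p2:
  fixes x y z :: real and n p m :: nat
  assumes "y \<noteq> 0" and "x + y \<noteq> 0" and "x / (x + y) \<ge> 0"
    and "z \<le> 1"
    and "n \<ge> 1" and "p \<ge> 1" and "m \<ge> 1"
  shows "(\<Sum>k=0..n. x ^ k * y ^ (n - k) * real (n choose k)
            * zeta_star k (replicate (p - 1) 1 @ [m + 1]) z)
       = (-1) ^ (m + p) * (x + y) ^ n
         * (\<Sum>j=1..n. \<Sum>l=1..j.
              (y / (x + y)) ^ j * ((1 + x * z / y) ^ l - 1)
              * (\<Sum>i=0..p - 1. (-1) ^ i * (harmonic_Y i n / fact i)
                    * (real (stirling j (p - i)) / fact j))
              * (\<Sum>h=0..m - 1. (-1) ^ h * (harmonic_Y h j / fact h)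
                    * (real (stirling l (m - h)) / fact l)))"
proof -
  define a b where "a = x / (x + y)" and "b = y / (x + y)"
  define v where "v = x * z / y"
  have ab: "a + b = 1" "b \<noteq> 0" "a * z / b = v"
    using assms(1,2) by (simp_all add: a_def b_def v_def add_divide_distrib[symmetric])
  obtain p' where p: "p = Suc p'" using assms(6) by (cases p) auto
  \<comment> \<open>By \<open>sum_stirling_weight_power\<close> this is the sum over l.\<close>
  define c where "c = (\<lambda>j. - (\<Sum>k=1..j. real (j choose k) * v ^ k / real k ^ m))"
  \<comment> \<open>The argument q is the depth of the star sum. Row q = 0 is chosen so that the
    recurrence in q and k already holds at depth 1.\<close>
  define \<zeta> where "\<zeta> = (\<lambda>q k. case q of
      0 \<Rightarrow> if k = 0 then 0 else z ^ k / real k ^ m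
    | Suc q \<Rightarrow> zeta_star k (replicate q 1 @ [m + 1]) z)"
  have \<zeta>_0: "\<zeta> q 0 = 0" for q
  proof (cases q)
    case (Suc r)
    then show ?thesis
      by (cases r) (simp_all add: \<zeta>_def zeta_star_Cons zeta_star_singleton)
  qed (simp add: \<zeta>_def)
  have \<zeta>_Suc: "\<zeta> (Suc q) (Suc k) = \<zeta> (Suc q) k + \<zeta> q (Suc k) / real (Suc k)" for q k
    by (cases q) (simp_all add: \<zeta>_def zeta_star_Cons zeta_star_singleton mult_ac)
  have transform: "(\<Sum>j=1..n. (b ^ j * c j) * stirling_weight n j (Suc p'))
      = binomial_transform a b (\<zeta> (Suc p')) n"
  proof (rule stirling_transform_unique)
    show "binomial_transform a b (\<zeta> (Suc q)) (Suc n) = binomial_transform a b (\<zeta> (Suc q)) n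
        + binomial_transform a b (\<zeta> q) (Suc n) / real (Suc n)" for n q
      by (rule binomial_transform_recurrence) (rule ab \<zeta>_Suc \<zeta>_0)+
    show "binomial_transform a b (\<zeta> (Suc q)) 0 = 0" for q
      by (simp add: binomial_transform_def \<zeta>_0)
    show "binomial_transform a b (\<zeta> 0) (Suc n) = - (b ^ Suc n * c (Suc n))" for n
    proof -
      have "binomial_transform a b (\<zeta> 0) (Suc n)
          = (\<Sum>k=1..Suc n. a ^ k * b ^ (Suc n - k) * real (Suc n choose k) * \<zeta> 0 k)"
        unfolding binomial_transform_def
        by (subst sum.atLeast_Suc_atMost) (simp_all add: \<zeta>_0)
      also have "\<dots> = (\<Sum>k=1..Suc n. b ^ Suc n * (real (Suc n choose k) * v ^ k / real k ^ m))"
      proof (rule sum.cong[OF refl])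
        fix k assume k: "k \<in> {1..Suc n}"
        \<comment> \<open>The factor b^k cancels the denominator of v^k = (a z / b)^k.\<close>
        then have "b ^ Suc n = b ^ (Suc n - k) * b ^ k"
          by (simp flip: power_add)
        then show "a ^ k * b ^ (Suc n - k) * real (Suc n choose k) * \<zeta> 0 k
            = b ^ Suc n * (real (Suc n choose k) * v ^ k / real k ^ m)"
          using k ab(2) by (simp add: \<zeta>_def power_divide power_mult_distrib
              del: binomial_Suc_Suc power_Suc flip: ab(3))
      qed
      finally show ?thesis by (simp only: c_def sum_distrib_left[symmetric] mult_minus_right minus_minus)
    qed
  qed
  have "(\<Sum>k=0..n. x ^ k * y ^ (n - k) * real (n choose k)
            * zeta_star k (replicate (p - 1) 1 @ [m + 1]) z)
      = (x + y) ^ n * binomial_transform a b (\<zeta> (Suc p')) n"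
    using binomial_transform_scale[OF assms(2), of x y "\<zeta> (Suc p')" n]
    by (simp add: binomial_transform_def \<zeta>_def p a_def b_def)
  also have "binomial_transform a b (\<zeta> (Suc p')) n
      = (\<Sum>j=1..n. \<Sum>l=1..j. b ^ j * ((1 + v) ^ l - 1)
          * stirling_weight n j p * stirling_weight j l m)"
    unfolding transform[symmetric] c_def sum_stirling_weight_power[OF assms(7), symmetric] p
    by (simp add: sum_distrib_left sum_distrib_right mult_ac)
  also have "\<dots> = (-1) ^ (m + p) * (\<Sum>j=1..n. \<Sum>l=1..j.
              b ^ j * ((1 + v) ^ l - 1)
              * (\<Sum>i=0..p - 1. (-1) ^ i * (harmonic_Y i n / fact i)
                    * (real (stirling j (p - i)) / fact j))
              * (\<Sum>h=0..m - 1. (-1) ^ h * (harmonic_Y h j / fact h)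
                    * (real (stirling l (m - h)) / fact l)))"
    unfolding sum_distrib_left[where r = "(-1) ^ (m + p)"]
    \<comment> \<open>Since j, l >= 1, \<open>stirling_weight_eq\<close> applies to both weights and
      yields the signs (-1)^p and (-1)^m.\<close>
    by (intro sum.cong refl) (simp add: stirling_weight_eq power_add mult_ac)
  finally show ?thesis
    by (simp add: b_def v_def mult_ac)
qed

end
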